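(* For all integers $i,j\ge 0$ there exists a bijection $$\alpha_{i,j}:\{\beta^{(i,j)}\}\times \mathscr{E}_{2,i}\times \mathscr{E}_{4,j}\to \mathscr{D}^{\mathrm{o}}_{i,j},\qquad (\beta^{(i,j)},\mu,\eta)\mapsto\lambda,$$ such that $|\lambda|=|\beta^{(i,j)}|+|\mu|+|\eta|$, $\ell(\lambda)=\ell(\beta^{(i,j)})$ and $\mathrm{sol}_2(\lambda)=\mathrm{sol}_2(\beta^{(i,j)})$. Further, $$\sum_{\lambda\in \mathscr{D}^{\mathrm{o}}}x^{\mathrm{sol}_2(\lambda)}y^{\ell(\lambda)}q^{|\lambda|}=\sum_{i, j\geq 0}\frac{x^iy^{i+2j}q^{2i^2+4j^2+4ij-i}}{(q^2; q^2)_i(q^4; q^4)_j}.$$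
   Context: A partition $\lambda$ is a finite weakly increasing list of positive integers (its parts); $|\lambda|$ is the sum of parts and $\ell(\lambda)$ the number of parts. $\mathscr{D}^{\mathrm{o}}$ is the set of partitions whose parts are distinct and odd. For $\lambda\in\mathscr{D}^{\mathrm{o}}$, a $2$-sequence of $\lambda$ is a maximal string of parts of $\lambda$ in which consecutive parts differ by exactly $2$; $\mathrm{sol}_2(\lambda)$ is the number of $2$-sequences of $\lambda$ of odd length. For $i,j\ge0$, $\mathscr{D}^{\mathrm{o}}_{i,j}=\{\lambda\in\mathscr{D}^{\mathrm{o}}:\ell(\lambda)=i+2j,\ \mathrm{sol}_2(\lambda)=i\}$. For $k\ge1$, $\mathscr{E}_{k,n}$ is the set of partitions all of whose parts are multiples of $k$ and which have at most $n$ parts. The base partition $\beta^{(i,j)}$ is the partition with parts $1,3,5,7,\dots,4j-3,4j-1$ (i.e. the $2j$ odd numbers $1,3,\dots,4j-1$) together with $4j+1,4j+5,\dots,4j+4i-3$; it satisfies $|\beta^{(i,j)}|=2i^2+4j^2+4ij-i$, $\ell(\beta^{(i,j)})=i+2j$, $\mathrm{sol}_2(\beta^{(i,j)})=i$. $(a;q)_n=\prod_{k=0}^{n-1}(1-aq^k)$. *)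

theory Defs
  imports
    "HOL-Analysis.Infinite_Sum"
    "HOL-Computational_Algebra.Formal_Power_Series"
begin

text \<open>
  A partition is the weakly increasing list of its parts; its weight is \<open>sum_list\<close> and its
  number of parts is \<open>length\<close>.
\<close>

definition is_partition :: "nat list \<Rightarrow> bool" where
  "is_partition \<pi> \<longleftrightarrow> sorted \<pi> \<and> (\<forall>p\<in>set \<pi>. 0 < p)"

definition distinct_odd_partitions :: "nat list set" where
  "distinct_odd_partitions = {\<pi>. is_partition \<pi> \<and> distinct \<pi> \<and> (\<forall>p\<in>set \<pi>. odd p)}"

text \<open>
  A string of parts is given by the half-open interval \<open>{a..<b}\<close> of (0-based) positions it
  occupies in the list, so it is nonempty and has length \<open>b - a\<close>. A single part is a string.
\<close>

definition is_2_string :: "nat list \<Rightarrow> nat \<Rightarrow> nat \<Rightarrow> bool" where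
  "is_2_string \<pi> a b \<longleftrightarrow>
     a < b \<and> b \<le> length \<pi> \<and> (\<forall>k. a \<le> k \<and> Suc k < b \<longrightarrow> \<pi> ! Suc k = \<pi> ! k + 2)"

definition is_2_sequence :: "nat list \<Rightarrow> nat \<Rightarrow> nat \<Rightarrow> bool" where
  "is_2_sequence \<pi> a b \<longleftrightarrow>
     is_2_string \<pi> a b \<and>
     (\<forall>a' b'. is_2_string \<pi> a' b' \<and> a' \<le> a \<and> b \<le> b' \<longrightarrow> a' = a \<and> b' = b)"

definition sol2 :: "nat list \<Rightarrow> nat" where
  "sol2 \<pi> = card {(a, b). is_2_sequence \<pi> a b \<and> odd (b - a)}"

definition distinct_odd_partitions_ij :: "nat \<Rightarrow> nat \<Rightarrow> nat list set" where
  "distinct_odd_partitions_ij i j =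
     {\<pi> \<in> distinct_odd_partitions. length \<pi> = i + 2 * j \<and> sol2 \<pi> = i}"

definition multiple_partitions :: "nat \<Rightarrow> nat \<Rightarrow> nat list set" where
  "multiple_partitions k n =
     {\<mu>. is_partition \<mu> \<and> (\<forall>p\<in>set \<mu>. k dvd p) \<and> length \<mu> \<le> n}"

definition base_partition :: "nat \<Rightarrow> nat \<Rightarrow> nat list" where
  "base_partition i j =
     map (\<lambda>k. 2 * k + 1) [0..<2 * j] @ map (\<lambda>k. 4 * j + 1 + 4 * k) [0..<i]"

definition qpochhammer :: "'a::comm_ring_1 \<Rightarrow> 'a \<Rightarrow> nat \<Rightarrow> 'a" where
  "qpochhammer a q n = (\<Prod>k<n. 1 - a * q ^ k)"

text \<open>
  The indeterminates \<open>x\<close>, \<open>y\<close>, \<open>q\<close> of the ring of formal power series in \<open>q\<close> whose coefficients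
  are formal power series in \<open>y\<close> and \<open>x\<close> over the rationals. The topology on this type, and hence
  the meaning of infinite sums, is the \<open>q\<close>-adic one. A quotient \<open>f / g\<close> is \<open>f * inverse g\<close> with
  \<open>inverse g\<close> the genuine inverse whenever the \<open>q\<close>-constant coefficient of \<open>g\<close> is 1.
\<close>

definition x_var :: "rat fps fps fps" where
  "x_var = fps_const (fps_const fps_X)"

definition y_var :: "rat fps fps fps" where
  "y_var = fps_const fps_X"

definition q_var :: "rat fps fps fps" where
  "q_var = fps_X"

end

theory Submission
  imports Defs
begin

text \<open>
  A partition in \<open>distinct_odd_partitions_ij i j\<close> other than the empty one arises in exactly one of
  three ways: by adding 2 to every part of a partition in the same set; by adding 4 to every part
  and prepending \<open>1, 3\<close>, which lengthens a 2-sequence by two parts or creates one of even length; or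
  by adding 4 to every part and prepending \<open>1\<close>, which creates a 2-sequence of length one. For the
  generating functions \<open>F(i, j)\<close> this gives
  \<open>(1 - q^(2i+4j)) F(i, j) = q^(4i+8j-4) F(i, j-1) + q^(4i+8j-3) F(i-1, j)\<close>,
  a recurrence that \<open>q^|base| / ((q^2;q^2)_i (q^4;q^4)_j)\<close> satisfies as well. Since this quotient also
  counts triples of a base partition and two partitions into multiples of 2 and 4 by weight, the
  sets to be matched have equally many elements of each weight, which yields the bijection.
  Summing over \<open>i\<close> and \<open>j\<close> gives the double series.
\<close>

section \<open>2-sequences\<close>

text \<open>Maximality need only be tested against extensions by one position: a strictly larger
  string contains position \<open>a - 1\<close> or \<open>b\<close>, hence the step of 2 across that
  end. In this local form the effect of prepending parts can be computed.\<close>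

lemma is_2_sequence_iff:
  "is_2_sequence \<pi> a b \<longleftrightarrow> is_2_string \<pi> a b \<and> (0 < a \<longrightarrow> \<pi> ! a \<noteq> \<pi> ! (a - 1) + 2)
     \<and> (b < length \<pi> \<longrightarrow> \<pi> ! b \<noteq> \<pi> ! (b - 1) + 2)"
proof
  assume L: "is_2_sequence \<pi> a b"
  then have s: "is_2_string \<pi> a b"
    and m: "\<And>a' b'. is_2_string \<pi> a' b' \<Longrightarrow> a' \<le> a \<Longrightarrow> b \<le> b' \<Longrightarrow> a' = a \<and> b' = b"
    by (auto simp: is_2_sequence_def)
  have "\<pi> ! a \<noteq> \<pi> ! (a - 1) + 2" if "0 < a"
  proof
    assume e: "\<pi> ! a = \<pi> ! (a - 1) + 2"
    have "\<pi> ! Suc k = \<pi> ! k + 2" if "a - 1 \<le> k" "Suc k < b" for k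
      using s e that \<open>0 < a\<close> by (cases "k = a - 1") (auto simp: is_2_string_def)
    then have "is_2_string \<pi> (a - 1) b"
      using s by (auto simp: is_2_string_def)
    from m[OF this] \<open>0 < a\<close> show False by auto
  qed
  moreover have "\<pi> ! b \<noteq> \<pi> ! (b - 1) + 2" if "b < length \<pi>"
  proof
    assume e: "\<pi> ! b = \<pi> ! (b - 1) + 2"
    have "\<pi> ! Suc k = \<pi> ! k + 2" if "a \<le> k" "Suc k < Suc b" for k
      using s e that by (cases "Suc k = b") (auto simp: is_2_string_def)
    then have "is_2_string \<pi> a (Suc b)"
      using s \<open>b < length \<pi>\<close> by (auto simp: is_2_string_def)
    from m[OF this] show False by auto
  qed
  ultimately show "is_2_string \<pi> a b \<and> (0 < a \<longrightarrow> \<pi> ! a \<noteq> \<pi> ! (a - 1) + 2)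
     \<and> (b < length \<pi> \<longrightarrow> \<pi> ! b \<noteq> \<pi> ! (b - 1) + 2)"
    using s by blast
next
  assume R: "is_2_string \<pi> a b \<and> (0 < a \<longrightarrow> \<pi> ! a \<noteq> \<pi> ! (a - 1) + 2)
     \<and> (b < length \<pi> \<longrightarrow> \<pi> ! b \<noteq> \<pi> ! (b - 1) + 2)"
  have "a' = a \<and> b' = b" if s': "is_2_string \<pi> a' b'" "a' \<le> a" "b \<le> b'" for a' b'
  proof (rule ccontr)
    assume "\<not> (a' = a \<and> b' = b)"
    have step: "\<pi> ! Suc k = \<pi> ! k + 2" if "a' \<le> k" "Suc k < b'" for k
      using s' that by (auto simp: is_2_string_def)
    have "a < b" using R by (auto simp: is_2_string_def)
    from \<open>\<not> (a' = a \<and> b' = b)\<close> consider "a' < a" | "b < b'" using s' by linarith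
    then show False
    proof cases
      case 1
      with step[of "a - 1"] \<open>a < b\<close> s' have "\<pi> ! a = \<pi> ! (a - 1) + 2" by simp
      with 1 R show False by simp
    next
      case 2
      with step[of "b - 1"] \<open>a < b\<close> s' have "\<pi> ! b = \<pi> ! (b - 1) + 2" by simp
      moreover have "b < length \<pi>" using 2 s' by (auto simp: is_2_string_def)
      ultimately show False using R \<open>a < b\<close> by simp
    qed
  qed
  with R show "is_2_sequence \<pi> a b" by (auto simp: is_2_sequence_def)
qed

lemma is_2_string_Cons_Suc:
  "is_2_string (x # \<pi>) (Suc a) (Suc b) \<longleftrightarrow> is_2_string \<pi> a b"
proof -
  have "(\<forall>k. Suc a \<le> k \<and> Suc k < Suc b \<longrightarrow> (x # \<pi>) ! Suc k = (x # \<pi>) ! k + 2) \<longleftrightarrow>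
      (\<forall>k. a \<le> k \<and> Suc k < b \<longrightarrow> \<pi> ! Suc k = \<pi> ! k + 2)" (is "?L \<longleftrightarrow> ?R")
  proof
    assume L: ?L
    show ?R using L by (auto dest: spec[of _ "Suc _"])
  next
    assume R: ?R
    show ?L
    proof (intro allI impI)
      fix k assume "Suc a \<le> k \<and> Suc k < Suc b"
      with R show "(x # \<pi>) ! Suc k = (x # \<pi>) ! k + 2" by (cases k) auto
    qed
  qed
  then show ?thesis by (simp add: is_2_string_def)
qed

text \<open>A 2-sequence is determined by its end position, and prepending parts to a list shifts the end
  positions of its 2-sequences uniformly, whereas the start position of the first one may stay 0.\<close>

definition odd_ends :: "nat list \<Rightarrow> nat set" where
  "odd_ends \<pi> = {b. \<exists>a. is_2_sequence \<pi> a b \<and> odd (b - a)}"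

text \<open>Two strings with a common end are nested, so the longer one extends both and maximality
  forces equality.\<close>

lemma is_2_sequence_start_unique:
  assumes "is_2_sequence \<pi> a b" "is_2_sequence \<pi> a' b"
  shows "a = a'"
proof -
  have "is_2_string \<pi> (min a a') b"
    using assms by (auto simp: is_2_sequence_def min_def)
  then show ?thesis using assms unfolding is_2_sequence_def
    by (metis min.cobounded1 min.cobounded2 order_refl)
qed

lemma sol2_eq_card_odd_ends: "sol2 \<pi> = card (odd_ends \<pi>)"
proof -
  have "odd_ends \<pi> = snd ` {(a, b). is_2_sequence \<pi> a b \<and> odd (b - a)}"
    by (force simp: odd_ends_def)
  moreover have "inj_on snd {(a, b). is_2_sequence \<pi> a b \<and> odd (b - a)}"
    by (auto simp: inj_on_def intro: is_2_sequence_start_unique)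
  ultimately show ?thesis by (simp add: sol2_def card_image)
qed

lemma odd_ends_subset: "odd_ends \<pi> \<subseteq> {0<..length \<pi>}"
  by (auto simp: odd_ends_def is_2_sequence_def is_2_string_def)

lemma finite_odd_ends: "finite (odd_ends \<pi>)"
  using odd_ends_subset finite_subset by blast

lemma sol2_Nil [simp]: "sol2 [] = 0"
  using odd_ends_subset[of "[]"] by (simp add: sol2_eq_card_odd_ends)

section \<open>Effect of prepending and shifting parts on \<open>sol2\<close>\<close>

text \<open>The gap after \<open>x\<close> makes it a 2-sequence of length one and leaves the others
  intact, with both ends moved by one position.\<close>

lemma sol2_Cons_gap:
  assumes "\<pi> = [] \<or> hd \<pi> \<noteq> x + 2"
  shows "sol2 (x # \<pi>) = Suc (sol2 \<pi>)"
proof -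
  have gap: "\<pi> = [] \<or> \<pi> ! 0 \<noteq> x + 2"
    using assms by (auto simp: hd_conv_nth)
  have S: "is_2_sequence (x # \<pi>) (Suc a) (Suc b) \<longleftrightarrow> is_2_sequence \<pi> a b" for a b
    unfolding is_2_sequence_iff is_2_string_Cons_Suc
    using gap by (cases a; cases b) (auto simp: is_2_string_def)
  have Z: "is_2_sequence (x # \<pi>) 0 b \<longleftrightarrow> b = 1" for b
  proof
    assume b: "is_2_sequence (x # \<pi>) 0 b"
    show "b = 1"
    proof (rule ccontr)
      assume "b \<noteq> 1"
      with b have "\<pi> ! 0 = x + 2" "0 < length \<pi>"
        by (auto simp: is_2_sequence_iff is_2_string_def dest!: spec[of _ "0::nat"])
      with gap show False by simp
    qed
  qed (use gap in \<open>auto simp: is_2_sequence_iff is_2_string_def\<close>)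
  have "b \<in> odd_ends (x # \<pi>) \<longleftrightarrow> b \<in> insert 1 (Suc ` odd_ends \<pi>)" for b
  proof
    assume "b \<in> odd_ends (x # \<pi>)"
    then obtain a where a: "is_2_sequence (x # \<pi>) a b" "odd (b - a)" by (auto simp: odd_ends_def)
    show "b \<in> insert 1 (Suc ` odd_ends \<pi>)"
    proof (cases a)
      case 0 with a Z show ?thesis by simp
    next
      case (Suc a')
      from a obtain b' where "b = Suc b'" by (cases b) auto
      with a Suc S show ?thesis by (auto simp: odd_ends_def)
    qed
  next
    assume "b \<in> insert 1 (Suc ` odd_ends \<pi>)"
    then show "b \<in> odd_ends (x # \<pi>)"
    proof
      assume "b = 1"
      with Z[of 1] show ?thesis unfolding odd_ends_def by (auto intro!: exI[of _ 0])
    next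
      assume "b \<in> Suc ` odd_ends \<pi>"
      then obtain a b' where "b = Suc b'" "is_2_sequence \<pi> a b'" "odd (b' - a)"
        by (auto simp: odd_ends_def)
      with S[of a b'] show ?thesis unfolding odd_ends_def by (auto intro!: exI[of _ "Suc a"])
    qed
  qed
  then have "odd_ends (x # \<pi>) = insert 1 (Suc ` odd_ends \<pi>)" by blast
  \<comment> \<open>End positions are at least 1, so shifted ones are at least 2 and the new end 1
    is counted separately.\<close>
  moreover have "1 \<notin> Suc ` odd_ends \<pi>" using odd_ends_subset by fastforce
  ultimately show ?thesis
    by (simp add: sol2_eq_card_odd_ends finite_odd_ends card_image)
qed

text \<open>The pair either prolongs the first 2-sequence of \<open>\<pi>\<close> by two parts or is
  a 2-sequence of even length by itself. In both cases the odd ones correspond, with their ends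
  moved by two.\<close>

lemma sol2_Cons_pair: "sol2 (x # (x + 2) # \<pi>) = sol2 \<pi>"
proof -
  let ?p = "x # (x + 2) # \<pi>"
  have S: "is_2_string ?p (Suc (Suc a)) (Suc (Suc b)) \<longleftrightarrow> is_2_string \<pi> a b" for a b
    by (simp add: is_2_string_Cons_Suc)
  \<comment> \<open>For \<open>a = 0\<close> the shifted string stays maximal only if the pair does
    not run into it.\<close>
  have SS: "is_2_sequence ?p (Suc (Suc a)) (Suc (Suc b)) \<longleftrightarrow>
      is_2_sequence \<pi> a b \<and> (a = 0 \<longrightarrow> \<pi> ! 0 \<noteq> x + 4)" for a b
    unfolding is_2_sequence_iff S by (cases a; cases b) (auto simp: is_2_string_def)
  \<comment> \<open>If the pair does run into the first string, that string now starts at position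
    0.\<close>
  have S0: "is_2_string ?p 0 (Suc (Suc b)) \<longleftrightarrow> is_2_string \<pi> 0 b \<and> \<pi> ! 0 = x + 4"
    if "0 < b" for b
  proof
    assume L: "is_2_string ?p 0 (Suc (Suc b))"
    have "is_2_string ?p (Suc (Suc 0)) (Suc (Suc b))"
      using L that by (auto simp: is_2_string_def)
    moreover have "\<pi> ! 0 = x + 4"
      using L that by (auto simp: is_2_string_def dest!: spec[of _ 1])
    ultimately show "is_2_string \<pi> 0 b \<and> \<pi> ! 0 = x + 4" unfolding S by blast
  next
    assume R: "is_2_string \<pi> 0 b \<and> \<pi> ! 0 = x + 4"
    have "?p ! Suc k = ?p ! k + 2" if "Suc k < Suc (Suc b)" for k
    proof (cases k)
      case (Suc k')
      with R that show ?thesis by (cases k') (auto simp: is_2_string_def)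
    qed simp
    with R show "is_2_string ?p 0 (Suc (Suc b))" by (auto simp: is_2_string_def)
  qed
  have Z: "is_2_sequence ?p 0 (Suc (Suc b)) \<longleftrightarrow> is_2_sequence \<pi> 0 b \<and> \<pi> ! 0 = x + 4"
    if "0 < b" for b
    unfolding is_2_sequence_iff S0[OF that] using that by auto
  \<comment> \<open>A string starting at \<open>x + 2\<close> can be prolonged to the left by
    \<open>x\<close>.\<close>
  have O: "\<not> is_2_sequence ?p (Suc 0) b" for b
    by (auto simp: is_2_sequence_iff)
  have "b \<in> odd_ends ?p \<longleftrightarrow> b \<in> (\<lambda>b. Suc (Suc b)) ` odd_ends \<pi>" for b
  proof
    assume "b \<in> odd_ends ?p"
    then obtain a where a: "is_2_sequence ?p a b" "odd (b - a)" by (auto simp: odd_ends_def)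
    have "b \<noteq> 1"
    proof
      assume "b = 1"
      with a have "a = 0" by (cases a) auto
      with a \<open>b = 1\<close> show False by (auto simp: is_2_sequence_iff)
    qed
    with a obtain b' where b: "b = Suc (Suc b')" by (metis One_nat_def diff_0_eq_0 even_zero not0_implies_Suc)
    show "b \<in> (\<lambda>b. Suc (Suc b)) ` odd_ends \<pi>"
    proof (cases a)
      case 0
      \<comment> \<open>Parity excludes \<open>b' = 0\<close>, where the pair is a 2-sequence on its
        own, and so makes \<open>Z\<close> applicable.\<close>
      with a b have "odd b'" by simp
      then have "0 < b'" by (rule odd_pos)
      with a b Z[of b'] 0 \<open>odd b'\<close> show ?thesis by (auto simp: odd_ends_def intro!: exI[of _ 0])
    next
      case (Suc a')
      with a O obtain a'' where "a = Suc (Suc a'')" by (cases a') auto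
      with a b SS show ?thesis by (auto simp: odd_ends_def)
    qed
  next
    assume "b \<in> (\<lambda>b. Suc (Suc b)) ` odd_ends \<pi>"
    then obtain a b' where b: "b = Suc (Suc b')" "is_2_sequence \<pi> a b'" "odd (b' - a)"
      by (auto simp: odd_ends_def)
    then have "0 < b'" by (metis diff_0_eq_0 even_zero gr0I)
    show "b \<in> odd_ends ?p"
    \<comment> \<open>Only the start of the corresponding 2-sequence depends on whether the pair
      merges with it: 0 if it does, \<open>a + 2\<close> otherwise.\<close>
    proof (cases "a = 0 \<and> \<pi> ! 0 = x + 4")
      case True
      with b Z[of b'] \<open>0 < b'\<close> show ?thesis unfolding odd_ends_def
        by (auto intro!: exI[of _ 0])
    next
      case False
      with b SS[of a b'] show ?thesis unfolding odd_ends_def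
        by (auto intro!: exI[of _ "Suc (Suc a)"])
    qed
  qed
  then have "odd_ends ?p = (\<lambda>b. Suc (Suc b)) ` odd_ends \<pi>" by blast
  then show ?thesis
    by (simp add: sol2_eq_card_odd_ends card_image inj_on_def)
qed

text \<open>Strings depend only on differences of neighbouring parts within the list, where the
  summand \<open>c\<close> cancels.\<close>

lemma sol2_map_add: "sol2 (map ((+) c) \<pi>) = sol2 \<pi>"
proof -
  have "map ((+) c) \<pi> ! Suc k = map ((+) c) \<pi> ! k + 2 \<longleftrightarrow> \<pi> ! Suc k = \<pi> ! k + 2"
    if "Suc k < length \<pi>" for k
    using that by simp
  then have "is_2_string (map ((+) c) \<pi>) a b \<longleftrightarrow> is_2_string \<pi> a b" for a b
    unfolding is_2_string_def by (metis length_map order_less_le_trans)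
  then show ?thesis by (simp add: sol2_def is_2_sequence_def)
qed

text \<open>Removing a leading pair \<open>x, x + 2\<close> keeps \<open>sol2\<close> and lowers the
  length by two; removing a leading part followed by a gap lowers both by one. Hence every partition
  into distinct odd parts has indices \<open>i\<close> and \<open>j\<close>.\<close>

lemma sol2_add_even_length: "\<exists>j. length \<pi> = sol2 \<pi> + 2 * j"
proof (induction \<pi> rule: length_induct)
  case (1 \<pi>)
  show ?case
  proof (cases \<pi>)
    case (Cons x r)
    show ?thesis
    proof (cases "r \<noteq> [] \<and> hd r = x + 2")
      case True
      then obtain s where "\<pi> = x # (x + 2) # s" using Cons by (cases r) auto
      then have "length s < length \<pi>" by simp
      with 1 obtain j where "length s = sol2 s + 2 * j" by blast
      with \<open>\<pi> = x # (x + 2) # s\<close> show ?thesis by (intro exI[of _ "Suc j"]) (simp add: sol2_Cons_pair[simplified])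
    next
      case False
      have "length r < length \<pi>" using Cons by simp
      with 1 obtain j where "length r = sol2 r + 2 * j" by blast
      with Cons False show ?thesis by (intro exI[of _ j]) (auto simp: sol2_Cons_gap)
    qed
  qed simp
qed

section \<open>Counting by weight\<close>

text \<open>The value of \<open>card\<close> on an infinite fibre is 0, hence the condition
  \<open>finite_fibers\<close> below. The coefficient ring is left open: the bijection uses the
  rationals, the double series uses power series in x and y.\<close>

definition weight_gf :: "('b \<Rightarrow> nat) \<Rightarrow> 'b set \<Rightarrow> 'a::comm_ring_1 fps" where
  "weight_gf w S = Abs_fps (\<lambda>n. of_nat (card {x \<in> S. w x = n}))"

definition finite_fibers :: "('b \<Rightarrow> nat) \<Rightarrow> 'b set \<Rightarrow> bool" where
  "finite_fibers w S \<longleftrightarrow> (\<forall>n. finite {x \<in> S. w x = n})"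

lemma weight_gf_nth [simp]: "fps_nth (weight_gf w S) n = of_nat (card {x \<in> S. w x = n})"
  by (simp add: weight_gf_def)

lemma finite_fibers_subset: "finite_fibers w T \<Longrightarrow> S \<subseteq> T \<Longrightarrow> finite_fibers w S"
  unfolding finite_fibers_def by (blast intro: rev_finite_subset)

lemma weight_gf_singleton: "weight_gf w {a} = (fps_X ^ w a :: 'a::comm_ring_1 fps)"
proof (rule fps_ext)
  fix n
  have "{x \<in> {a}. w x = n} = (if n = w a then {a} else {})" by auto
  then show "fps_nth (weight_gf w {a}) n = fps_nth (fps_X ^ w a :: 'a fps) n" by (auto simp: fps_X_power_nth)
qed

lemma weight_gf_Un:
  assumes "finite_fibers w S" "finite_fibers w T" "S \<inter> T = {}"
  shows "weight_gf w (S \<union> T) = (weight_gf w S + weight_gf w T :: 'a::comm_ring_1 fps)"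
proof (rule fps_ext)
  fix n
  have "{x \<in> S \<union> T. w x = n} = {x \<in> S. w x = n} \<union> {x \<in> T. w x = n}" by auto
  then have "card {x \<in> S \<union> T. w x = n} = card {x \<in> S. w x = n} + card {x \<in> T. w x = n}"
    using assms by (auto simp: finite_fibers_def intro!: card_Un_disjoint)
  then show "fps_nth (weight_gf w (S \<union> T)) n = fps_nth (weight_gf w S + weight_gf w T :: 'a fps) n" by simp
qed

lemma weight_gf_image:
  assumes "inj_on f S" "\<And>x. x \<in> S \<Longrightarrow> w (f x) = w' x + c"
  shows "weight_gf w (f ` S) = (fps_X ^ c * weight_gf w' S :: 'a::comm_ring_1 fps)"
proof (rule fps_ext)
  fix n
  show "fps_nth (weight_gf w (f ` S)) n = fps_nth (fps_X ^ c * weight_gf w' S :: 'a fps) n"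
  proof (cases "n < c")
    case True
    then have "{x \<in> f ` S. w x = n} = {}" using assms(2) by auto
    then have "card {x \<in> f ` S. w x = n} = 0" by (metis card.empty)
    with True show ?thesis by (simp only: weight_gf_nth fps_X_power_mult_nth if_True of_nat_0)
  next
    case False
    then have "{x \<in> f ` S. w x = n} = f ` {x \<in> S. w' x = n - c}" using assms(2) by auto
    moreover have "inj_on f {x \<in> S. w' x = n - c}" by (rule inj_on_subset[OF assms(1)]) auto
    ultimately show ?thesis using False by (simp add: fps_X_power_mult_nth card_image)
  qed
qed

text \<open>Distributing the weight \<open>n\<close> over the two components produces the index
  pattern of the Cauchy product.\<close>

lemma fiber_Times:
  fixes w :: "'a \<Rightarrow> nat" and v :: "'b \<Rightarrow> nat"
  shows "{x \<in> S \<times> T. w (fst x) + v (snd x) = n} =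
    (\<Union>i\<in>{0..n}. {x \<in> S. w x = i} \<times> {y \<in> T. v y = n - i})"
  by auto

lemma finite_fibers_Times:
  assumes "finite_fibers w S" "finite_fibers v T"
  shows "finite_fibers (\<lambda>x. w (fst x) + v (snd x)) (S \<times> T)"
  unfolding finite_fibers_def fiber_Times using assms by (auto simp: finite_fibers_def)

lemma weight_gf_Times:
  assumes "finite_fibers w S" "finite_fibers v T"
  shows "weight_gf (\<lambda>x. w (fst x) + v (snd x)) (S \<times> T) = (weight_gf w S * weight_gf v T :: 'c::comm_ring_1 fps)"
proof (rule fps_ext)
  fix n
  have "card {x \<in> S \<times> T. w (fst x) + v (snd x) = n} =
      (\<Sum>i\<in>{0..n}. card ({x \<in> S. w x = i} \<times> {y \<in> T. v y = n - i}))"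
    unfolding fiber_Times using assms
    by (intro card_UN_disjoint) (auto simp: finite_fibers_def)
  then show "fps_nth (weight_gf (\<lambda>x. w (fst x) + v (snd x)) (S \<times> T)) n
      = fps_nth (weight_gf w S * weight_gf v T :: 'c fps) n"
    by (simp add: fps_mult_nth card_cartesian_product)
qed

text \<open>In characteristic 0 equal coefficients mean fibres of equal size. Bijections between the
  fibres are glued by letting the weight of \<open>x\<close> choose the one to apply; images of
  different fibres stay apart because weights are kept.\<close>

lemma weight_preserving_bij:
  fixes w :: "'b \<Rightarrow> nat" and v :: "'c \<Rightarrow> nat"
  assumes "finite_fibers w S" "finite_fibers v T"
    and eq: "weight_gf w S = (weight_gf v T :: 'a::{comm_ring_1, semiring_char_0} fps)"
  obtains f where "bij_betw f S T" "\<And>x. x \<in> S \<Longrightarrow> v (f x) = w x"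
proof -
  have "card {x \<in> S. w x = n} = card {y \<in> T. v y = n}" for n
    using arg_cong[OF eq, of "\<lambda>F. fps_nth F n"] by simp
  then have "\<exists>f. bij_betw f {x \<in> S. w x = n} {y \<in> T. v y = n}" for n
    using assms(1,2) by (intro finite_same_card_bij) (auto simp: finite_fibers_def)
  then obtain f where f: "\<And>n. bij_betw (f n) {x \<in> S. w x = n} {y \<in> T. v y = n}" by metis
  let ?f = "\<lambda>x. f (w x) x"
  have m: "f (w x) x \<in> T \<and> v (f (w x) x) = w x" if "x \<in> S" for x
    using bij_betwE[OF f[of "w x"]] that by auto
  have "inj_on ?f S"
  proof (rule inj_onI)
    fix x y assume xy: "x \<in> S" "y \<in> S" "f (w x) x = f (w y) y"
    with m have "w x = w y" by metis
    with xy show "x = y" using bij_betw_imp_inj_on[OF f[of "w y"]] by (auto dest: inj_onD)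
  qed
  moreover have "?f ` S = T"
  proof
    show "T \<subseteq> ?f ` S"
    proof
      fix y assume "y \<in> T"
      then have "y \<in> f (v y) ` {x \<in> S. w x = v y}" using bij_betw_imp_surj_on[OF f[of "v y"]] by auto
      then show "y \<in> ?f ` S" by force
    qed
  qed (use m in auto)
  ultimately show thesis using m by (intro that[of ?f]) (auto simp: bij_betw_def)
qed

text \<open>Positivity of the entries bounds the length, as well as each entry, by the sum.\<close>

lemma finite_fibers_positive_lists: "finite_fibers sum_list {xs :: nat list. \<forall>p \<in> set xs. 0 < p}"
  unfolding finite_fibers_def
proof
  fix n
  have "length xs \<le> sum_list xs" if "\<forall>p \<in> set xs. 0 < p" for xs :: "nat list"
    using that by (induction xs) auto
  then have "{x \<in> {xs. \<forall>p \<in> set xs. 0 < p}. sum_list x = n} \<subseteq> {xs. set xs \<subseteq> {..n} \<and> length xs \<le> n}"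
    using member_le_sum_list by fastforce
  moreover have "finite {xs. set xs \<subseteq> {..n} \<and> length xs \<le> n}"
    by (rule finite_lists_length_le) simp
  ultimately show "finite {x \<in> {xs. \<forall>p \<in> set xs. 0 < p}. sum_list x = n}" by (rule finite_subset)
qed

lemma sum_list_map_add: "sum_list (map ((+) c) xs) = sum_list xs + c * length xs" for c :: nat
  by (induction xs) auto

section \<open>Partitions into at most \<open>n\<close> multiples of \<open>k\<close>\<close>

lemma multiple_partitions_0: "multiple_partitions k 0 = {[]}"
  by (auto simp: multiple_partitions_def is_partition_def)

lemma finite_fibers_multiple_partitions: "finite_fibers sum_list (multiple_partitions k n)"
  by (rule finite_fibers_subset[OF finite_fibers_positive_lists])
     (auto simp: multiple_partitions_def is_partition_def)

text \<open>Padding with zeros to \<open>n\<close> parts first makes every partition with at most \<open>n\<close> parts gain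
  exactly \<open>k * n\<close> in weight.\<close>

definition add_column :: "nat \<Rightarrow> nat \<Rightarrow> nat list \<Rightarrow> nat list" where
  "add_column k n \<mu> = map ((+) k) (replicate (n - length \<mu>) 0 @ \<mu>)"

text \<open>Subtracting \<open>k\<close> and dropping zeros undoes \<open>add_column\<close>: as the
  parts are positive, exactly the padding disappears.\<close>

lemma filter_add_column:
  assumes "\<forall>p \<in> set \<mu>. 0 < p"
  shows "filter (\<lambda>p. 0 < p) (map (\<lambda>p. p - k) (add_column k n \<mu>)) = \<mu>"
  using assms by (simp add: add_column_def o_def filter_id_conv)

text \<open>By sortedness the parts equal to \<open>k\<close> come first, so the padding restores in
  place the zeros that were dropped. Once the head exceeds \<open>k\<close>, nothing is
  dropped.\<close>

lemma add_column_filter: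
  assumes "sorted \<nu>" "\<forall>p \<in> set \<nu>. k \<le> p"
  shows "add_column k (length \<nu>) (filter (\<lambda>p. 0 < p) (map (\<lambda>p. p - k) \<nu>)) = \<nu>"
  using assms
proof (induction \<nu>)
  case (Cons a \<nu>)
  let ?f = "\<lambda>\<nu>. filter (\<lambda>p. 0 < p) (map (\<lambda>p. p - k) \<nu>)"
  show ?case
  proof (cases "a = k")
    case True
    \<comment> \<open>This bound lets \<open>Suc\<close> be pulled out of the truncated difference
      that counts the padding.\<close>
    have "length (?f \<nu>) \<le> length \<nu>" by (metis length_filter_le length_map)
    with Cons True show ?thesis by (simp add: add_column_def Suc_diff_le)
  next
    case False
    with Cons have "\<forall>p \<in> set (a # \<nu>). k < p" by auto
    then have "?f (a # \<nu>) = map (\<lambda>p. p - k) (a # \<nu>)" by (subst filter_id_conv) auto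
    with Cons show ?thesis unfolding add_column_def by (auto simp: map_idI)
  qed
qed (simp add: add_column_def)

text \<open>With exactly \<open>Suc n\<close> parts, each is a positive multiple of \<open>k\<close>
  and so at least \<open>k\<close>; taking \<open>k\<close> off every part may leave fewer
  parts.\<close>

lemma multiple_partitions_Suc:
  assumes "0 < k"
  shows "multiple_partitions k (Suc n) =
    multiple_partitions k n \<union> add_column k (Suc n) ` multiple_partitions k (Suc n)"
proof
  show "multiple_partitions k (Suc n) \<subseteq>
    multiple_partitions k n \<union> add_column k (Suc n) ` multiple_partitions k (Suc n)"
  proof
    fix \<nu> assume \<nu>: "\<nu> \<in> multiple_partitions k (Suc n)"
    show "\<nu> \<in> multiple_partitions k n \<union> add_column k (Suc n) ` multiple_partitions k (Suc n)"
    proof (cases "length \<nu> \<le> n")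
      case False
      with \<nu> have len: "length \<nu> = Suc n" by (simp add: multiple_partitions_def)
      let ?\<mu> = "filter (\<lambda>p. 0 < p) (map (\<lambda>p. p - k) \<nu>)"
      have "sorted \<nu>" "\<forall>p \<in> set \<nu>. k \<le> p"
        using \<nu> by (auto simp: multiple_partitions_def is_partition_def dest: dvd_imp_le)
      then have "add_column k (Suc n) ?\<mu> = \<nu>" using add_column_filter len by metis
      moreover have "sorted ?\<mu>"
        using \<open>sorted \<nu>\<close> by (intro sorted_wrt_filter) (auto simp: sorted_map intro: sorted_wrt_mono_rel[rotated])
      moreover have "length ?\<mu> \<le> Suc n" using len by (metis length_filter_le length_map)
      ultimately show ?thesis
        using \<nu> by (force simp: multiple_partitions_def is_partition_def intro!: image_eqI[of _ _ ?\<mu>])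
    qed (use \<nu> in \<open>auto simp: multiple_partitions_def\<close>)
  qed
next
  have "add_column k (Suc n) \<mu> \<in> multiple_partitions k (Suc n)"
    if "\<mu> \<in> multiple_partitions k (Suc n)" for \<mu>
    using that assms
    by (auto simp: multiple_partitions_def is_partition_def add_column_def sorted_append sorted_map)
  then show "multiple_partitions k n \<union> add_column k (Suc n) ` multiple_partitions k (Suc n)
      \<subseteq> multiple_partitions k (Suc n)"
    by (auto simp: multiple_partitions_def)
qed

text \<open>With \<open>H n\<close> for the series, the decomposition above reads H(n+1) = H(n) +
  X^(k(n+1)) H(n+1), so each step contributes one factor of the product.\<close>

lemma weight_gf_multiple_partitions:
  assumes "0 < k"
  shows "weight_gf sum_list (multiple_partitions k n) * qpochhammer (fps_X ^ k) (fps_X ^ k) n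
    = (1 :: 'a::comm_ring_1 fps)"
proof (induction n)
  case 0
  show ?case by (simp add: multiple_partitions_0 weight_gf_singleton qpochhammer_def)
next
  case (Suc n)
  let ?H = "\<lambda>n. weight_gf sum_list (multiple_partitions k n) :: 'a fps"
  let ?S = "multiple_partitions k (Suc n)"
  have fin: "finite_fibers sum_list (add_column k (Suc n) ` ?S)"
    by (rule finite_fibers_subset[OF finite_fibers_multiple_partitions[of k "Suc n"]])
       (use multiple_partitions_Suc[OF assms, of n] in blast)
  \<comment> \<open>A padded partition has \<open>Suc n\<close> parts, one too many for the first
    set.\<close>
  have "multiple_partitions k n \<inter> add_column k (Suc n) ` ?S = {}"
    by (auto simp: multiple_partitions_def add_column_def)
  then have "?H (Suc n) = ?H n + weight_gf sum_list (add_column k (Suc n) ` ?S)"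
    using multiple_partitions_Suc[OF assms, of n] fin
    by (metis weight_gf_Un finite_fibers_multiple_partitions)
  moreover have "weight_gf sum_list (add_column k (Suc n) ` ?S) = fps_X ^ (k * Suc n) * ?H (Suc n)"
  proof (rule weight_gf_image)
    show "inj_on (add_column k (Suc n)) ?S"
      by (rule inj_on_inverseI[where g = "\<lambda>\<nu>. filter (\<lambda>p. 0 < p) (map (\<lambda>p. p - k) \<nu>)"])
         (auto simp: multiple_partitions_def is_partition_def intro!: filter_add_column)
    show "sum_list (add_column k (Suc n) \<mu>) = sum_list \<mu> + k * Suc n" if "\<mu> \<in> ?S" for \<mu>
      using that unfolding add_column_def sum_list_map_add
      by (simp add: multiple_partitions_def sum_list_replicate)
  qed
  ultimately have "?H (Suc n) * (1 - fps_X ^ (k * Suc n)) = ?H n" by (simp add: algebra_simps)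
  \<comment> \<open>The factors of \<open>qpochhammer\<close> are indexed from 0, so the last of
    \<open>Suc n\<close> factors carries the exponent \<open>n\<close> on top of the leading
    \<open>fps_X ^ k\<close>.\<close>
  moreover have "(fps_X ^ k * (fps_X ^ k) ^ n :: 'a fps) = fps_X ^ (k * Suc n)"
    by (simp add: power_mult power_add)
  ultimately have "?H (Suc n) * qpochhammer (fps_X ^ k) (fps_X ^ k) (Suc n)
      = ?H n * qpochhammer (fps_X ^ k) (fps_X ^ k) n"
    by (simp add: qpochhammer_def mult.assoc[symmetric] mult.commute[of "prod _ _"])
  with Suc show ?case by simp
qed

section \<open>Partitions into distinct odd parts\<close>

lemma distinct_odd_partitions_iff:
  "\<pi> \<in> distinct_odd_partitions \<longleftrightarrow> sorted_wrt (<) \<pi> \<and> (\<forall>p\<in>set \<pi>. odd p)"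
  by (auto simp: distinct_odd_partitions_def is_partition_def strict_sorted_iff dest: odd_pos)

lemma distinct_odd_partitions_ij_iff:
  "\<pi> \<in> distinct_odd_partitions_ij i j \<longleftrightarrow>
    sorted_wrt (<) \<pi> \<and> (\<forall>p\<in>set \<pi>. odd p) \<and> length \<pi> = i + 2 * j \<and> sol2 \<pi> = i"
  by (simp add: distinct_odd_partitions_ij_def distinct_odd_partitions_iff)

definition shift_all :: "nat list \<Rightarrow> nat list" where
  "shift_all \<pi> = map ((+) 2) \<pi>"

definition insert_pair :: "nat list \<Rightarrow> nat list" where
  "insert_pair \<pi> = 1 # 3 # map ((+) 4) \<pi>"

definition insert_single :: "nat list \<Rightarrow> nat list" where
  "insert_single \<pi> = 1 # map ((+) 4) \<pi>"

lemma inj_shift_all: "inj_on shift_all S" and inj_insert_pair: "inj_on insert_pair S"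
  and inj_insert_single: "inj_on insert_single S"
  by (auto simp: inj_on_def shift_all_def insert_pair_def insert_single_def map_injective)

lemma sol2_insert_pair: "sol2 (insert_pair \<pi>) = sol2 \<pi>"
  using sol2_Cons_pair[of 1 "map ((+) 4) \<pi>"] by (simp add: insert_pair_def sol2_map_add numeral_3_eq_3)

lemma sol2_insert_single: "sol2 (insert_single \<pi>) = Suc (sol2 \<pi>)"
proof -
  \<comment> \<open>After the shift all parts are at least 4, so the prepended 1 is not continued by
    a 3.\<close>
  have "map ((+) 4) \<pi> = [] \<or> hd (map ((+) 4) \<pi>) \<noteq> 1 + 2" by (cases \<pi>) auto
  from sol2_Cons_gap[OF this] show ?thesis by (simp add: insert_single_def sol2_map_add)
qed

lemma shift_all_mem:
  "\<pi> \<in> distinct_odd_partitions_ij i j \<Longrightarrow> shift_all \<pi> \<in> distinct_odd_partitions_ij i j"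
  by (auto simp: distinct_odd_partitions_ij_iff shift_all_def sol2_map_add sorted_wrt_map)

lemma insert_pair_mem:
  "\<pi> \<in> distinct_odd_partitions_ij i j \<Longrightarrow> insert_pair \<pi> \<in> distinct_odd_partitions_ij i (Suc j)"
  by (simp add: distinct_odd_partitions_ij_iff sol2_insert_pair)
     (auto simp: insert_pair_def sorted_wrt_map)

lemma insert_single_mem:
  "\<pi> \<in> distinct_odd_partitions_ij i j \<Longrightarrow> insert_single \<pi> \<in> distinct_odd_partitions_ij (Suc i) j"
  by (simp add: distinct_odd_partitions_ij_iff sol2_insert_single)
     (auto simp: insert_single_def sorted_wrt_map)

text \<open>Undoes the shift contained in each of the three moves, with \<open>c\<close> being 2 or
  4; as \<open>c\<close> is even, the parts stay odd.\<close>

lemma unshift: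
  assumes "sorted_wrt (<) \<pi>" "\<forall>p\<in>set \<pi>. odd p" "\<forall>p\<in>set \<pi>. c \<le> p" "even c"
  obtains \<rho> where "\<pi> = map ((+) c) \<rho>" "\<rho> \<in> distinct_odd_partitions"
proof -
  define \<rho> where "\<rho> = map (\<lambda>p. p - c) \<pi>"
  have \<pi>: "\<pi> = map ((+) c) \<rho>" using assms(3) by (auto simp: \<rho>_def map_idI)
  have "sorted_wrt (<) \<rho>" using assms(1) by (simp add: \<pi> sorted_wrt_map)
  moreover have "\<forall>p\<in>set \<rho>. odd p" using assms(2,4) by (simp add: \<pi>)
  ultimately show thesis using that[OF \<pi>] by (simp add: distinct_odd_partitions_iff)
qed

text \<open>The smallest parts decide. If the first is not 1, all parts can be lowered by 2. If it
  is 1, either a 3 follows and the pair comes off, or any further part is at least 4 and the single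
  1 comes off.\<close>

lemma distinct_odd_partitions_ij_split:
  assumes "(i, j) \<noteq> (0, 0)" "\<pi> \<in> distinct_odd_partitions_ij i j"
  shows "\<pi> \<in> shift_all ` distinct_odd_partitions_ij i j
    \<or> (\<exists>j'. j = Suc j' \<and> \<pi> \<in> insert_pair ` distinct_odd_partitions_ij i j')
    \<or> (\<exists>i'. i = Suc i' \<and> \<pi> \<in> insert_single ` distinct_odd_partitions_ij i' j)"
proof -
  have \<pi>: "sorted_wrt (<) \<pi>" "\<forall>p\<in>set \<pi>. odd p" "length \<pi> = i + 2 * j" "sol2 \<pi> = i"
    using assms(2) by (auto simp: distinct_odd_partitions_ij_iff)
  then obtain a r where ar: "\<pi> = a # r" using assms(1) by (cases \<pi>) auto
  show ?thesis
  proof (cases "a = 1")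
    case False
    moreover have "odd a" using \<pi> ar by simp
    ultimately have "2 \<le> a" by presburger
    then have "\<forall>p\<in>set \<pi>. 2 \<le> p" using \<pi> ar by auto
    then obtain \<rho> where \<rho>: "\<pi> = map ((+) 2) \<rho>" "\<rho> \<in> distinct_odd_partitions"
      using unshift[OF \<pi>(1,2), of 2] even_numeral by blast
    have "length \<rho> = length \<pi>" "sol2 \<rho> = sol2 \<pi>" unfolding \<rho>(1) by (simp_all add: sol2_map_add)
    with \<rho>(2) \<pi>(3,4) have "\<rho> \<in> distinct_odd_partitions_ij i j" by (simp add: distinct_odd_partitions_ij_def)
    moreover have "\<pi> = shift_all \<rho>" using \<rho>(1) by (simp only: shift_all_def)
    ultimately show ?thesis by blast
  next
    case a: True
    have r: "sorted_wrt (<) r" "\<forall>p\<in>set r. odd p \<and> 1 < p" using \<pi> ar a by auto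
    show ?thesis
    proof (cases "r \<noteq> [] \<and> hd r = 3")
      case True
      then obtain s where s: "r = 3 # s" by (cases r) auto
      have "sorted_wrt (<) s" "\<forall>p\<in>set s. odd p" "\<forall>p\<in>set s. 4 \<le> p" "even (4 :: nat)"
        using r s by auto
      then obtain \<rho> where \<rho>: "s = map ((+) 4) \<rho>" "\<rho> \<in> distinct_odd_partitions"
        using unshift by blast
      then have ins: "\<pi> = insert_pair \<rho>" using ar a s by (simp add: insert_pair_def)
      then have sol: "sol2 \<rho> = i" and len: "Suc (Suc (length \<rho>)) = i + 2 * j"
        using \<pi> sol2_insert_pair[of \<rho>] by (auto simp: insert_pair_def)
      \<comment> \<open>The parity identity for \<open>\<rho>\<close> is what shows that
        \<open>j\<close> is positive here.\<close>
      moreover obtain m where "length \<rho> = sol2 \<rho> + 2 * m" using sol2_add_even_length by blast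
      ultimately have "j = Suc m" "length \<rho> = i + 2 * m" by auto
      with \<rho> sol have "\<rho> \<in> distinct_odd_partitions_ij i m" by (simp add: distinct_odd_partitions_ij_def)
      with ins \<open>j = Suc m\<close> show ?thesis by blast
    next
      case False
      have "4 \<le> p" if pr: "p \<in> set r" for p
      proof -
        obtain b s where b: "r = b # s" using pr by (cases r) auto
        with False r have "b \<noteq> 3" "odd b" "1 < b" by auto
        then have "4 \<le> b" by presburger
        with pr b r show ?thesis by auto
      qed
      then have "\<forall>p\<in>set r. 4 \<le> p" "\<forall>p\<in>set r. odd p" "even (4 :: nat)" using r by auto
      with r(1) obtain \<rho> where \<rho>: "r = map ((+) 4) \<rho>" "\<rho> \<in> distinct_odd_partitions"
        using unshift by blast
      then have ins: "\<pi> = insert_single \<rho>" using ar a by (simp add: insert_single_def)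
      then have "Suc (sol2 \<rho>) = i" "Suc (length \<rho>) = i + 2 * j"
        using \<pi> sol2_insert_single[of \<rho>] by (auto simp: insert_single_def)
      with \<rho> have "\<rho> \<in> distinct_odd_partitions_ij (sol2 \<rho>) j" by (auto simp: distinct_odd_partitions_ij_def)
      with ins \<open>Suc (sol2 \<rho>) = i\<close> show ?thesis by blast
    qed
  qed
qed

lemma distinct_odd_partitions_ij_0_0: "distinct_odd_partitions_ij 0 0 = {[]}"
  by (auto simp: distinct_odd_partitions_ij_iff)

lemma finite_fibers_distinct_odd: "finite_fibers sum_list distinct_odd_partitions"
  by (rule finite_fibers_subset[OF finite_fibers_positive_lists])
     (auto simp: distinct_odd_partitions_def is_partition_def)

lemma finite_fibers_distinct_odd_ij: "finite_fibers sum_list (distinct_odd_partitions_ij i j)"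
  by (rule finite_fibers_subset[OF finite_fibers_distinct_odd])
     (auto simp: distinct_odd_partitions_ij_def)

text \<open>The exponents are the weights added: 2 for each of \<open>i + 2 * j\<close> parts, 4 for
  each old part plus 1 + 3 for the pair, and 4 for each old part plus 1 for the single. A term whose
  index has no predecessor is 0.\<close>

lemma weight_gf_distinct_odd_ij_rec:
  assumes "(i, j) \<noteq> (0, 0)"
  defines "F \<equiv> \<lambda>i j. weight_gf sum_list (distinct_odd_partitions_ij i j) :: 'a::comm_ring_1 fps"
  shows "F i j = fps_X ^ (2 * (i + 2 * j)) * F i j
    + (case j of 0 \<Rightarrow> 0 | Suc j' \<Rightarrow> fps_X ^ (4 + 4 * (i + 2 * j')) * F i j')
    + (case i of 0 \<Rightarrow> 0 | Suc i' \<Rightarrow> fps_X ^ (1 + 4 * (i' + 2 * j)) * F i' j)"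
proof -
  let ?A = "distinct_odd_partitions_ij"
  let ?P = "case j of 0 \<Rightarrow> {} | Suc j' \<Rightarrow> insert_pair ` ?A i j'"
  let ?S = "case i of 0 \<Rightarrow> {} | Suc i' \<Rightarrow> insert_single ` ?A i' j"
  have un: "?A i j = (shift_all ` ?A i j \<union> ?P) \<union> ?S"
  proof
    show "?A i j \<subseteq> (shift_all ` ?A i j \<union> ?P) \<union> ?S"
      using distinct_odd_partitions_ij_split[OF assms(1)] by fastforce
    show "(shift_all ` ?A i j \<union> ?P) \<union> ?S \<subseteq> ?A i j"
      using shift_all_mem insert_pair_mem insert_single_mem by (auto split: nat.splits)
  qed
  have F_un: "F i j = weight_gf sum_list ((shift_all ` ?A i j \<union> ?P) \<union> ?S)"
    unfolding F_def by (rule arg_cong[OF un])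
  have fin: "finite_fibers sum_list S" if "S \<subseteq> (shift_all ` ?A i j \<union> ?P) \<union> ?S" for S
    using finite_fibers_subset[OF finite_fibers_distinct_odd_ij[of i j]] that un by metis
  \<comment> \<open>The first two parts tell the images apart: a shifted partition has no part 1,
    and after the 1 a pair goes on with 3, a single with at least 4 or not at all.\<close>
  have disj1: "shift_all ` ?A i j \<inter> ?P = {}"
    by (auto simp: shift_all_def insert_pair_def split: nat.splits)
  have disj2: "(shift_all ` ?A i j \<union> ?P) \<inter> ?S = {}"
    by (auto simp: shift_all_def insert_pair_def insert_single_def Cons_eq_map_conv map_eq_Cons_conv split: nat.splits)
  have A: "weight_gf sum_list (shift_all ` ?A i j) = fps_X ^ (2 * (i + 2 * j)) * F i j"
    unfolding F_def
    by (rule weight_gf_image[OF inj_shift_all])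
       (simp add: shift_all_def sum_list_map_add distinct_odd_partitions_ij_iff)
  have P: "weight_gf sum_list ?P
      = (case j of 0 \<Rightarrow> 0 | Suc j' \<Rightarrow> fps_X ^ (4 + 4 * (i + 2 * j')) * F i j')"
  proof (cases j)
    case 0
    then show ?thesis by (simp add: fps_eq_iff)
  next
    case (Suc j')
    have "weight_gf sum_list (insert_pair ` ?A i j') = fps_X ^ (4 + 4 * (i + 2 * j')) * F i j'"
      unfolding F_def
      by (rule weight_gf_image[OF inj_insert_pair])
         (simp add: insert_pair_def sum_list_map_add distinct_odd_partitions_ij_iff)
    with Suc show ?thesis by simp
  qed
  have S: "weight_gf sum_list ?S
      = (case i of 0 \<Rightarrow> 0 | Suc i' \<Rightarrow> fps_X ^ (1 + 4 * (i' + 2 * j)) * F i' j)"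
  proof (cases i)
    case 0
    then show ?thesis by (simp add: fps_eq_iff)
  next
    case (Suc i')
    have "weight_gf sum_list (insert_single ` ?A i' j) = fps_X ^ (1 + 4 * (i' + 2 * j)) * F i' j"
      unfolding F_def
      by (rule weight_gf_image[OF inj_insert_single])
         (simp add: insert_single_def sum_list_map_add distinct_odd_partitions_ij_iff)
    with Suc show ?thesis by simp
  qed
  have "F i j = weight_gf sum_list (shift_all ` ?A i j \<union> ?P) + weight_gf sum_list ?S"
    unfolding F_un by (rule weight_gf_Un[OF fin fin disj2]) blast+
  also have "weight_gf sum_list (shift_all ` ?A i j \<union> ?P)
      = (weight_gf sum_list (shift_all ` ?A i j) + weight_gf sum_list ?P :: 'a fps)"
    by (rule weight_gf_Un[OF fin fin disj1]) blast+
  finally show ?thesis unfolding A P S .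
qed

section \<open>Solving the recurrence in closed form\<close>

text \<open>The weight of \<open>base_partition i j\<close>. The natural-number subtraction is exact
  because \<open>i \<le> 2 * i * i\<close>.\<close>

definition base_weight :: "nat \<Rightarrow> nat \<Rightarrow> nat" where
  "base_weight i j = 2 * i\<^sup>2 + 4 * j\<^sup>2 + 4 * i * j - i"

lemma base_weight_0_0 [simp]: "base_weight 0 0 = 0"
  by (simp add: base_weight_def)

lemma base_weight_Suc1: "base_weight (Suc i) j = 1 + 4 * (i + j) + base_weight i j"
proof -
  have "i \<le> i * (i * 2)" by (cases i) auto
  then have "i \<le> i * (i * 2) + (i * (j * 4) + j * (j * 4))" by (rule trans_le_add1)
  then show ?thesis by (simp add: base_weight_def power2_eq_square algebra_simps)
qed

lemma base_weight_Suc2: "base_weight i (Suc j) = 4 + 4 * i + 8 * j + base_weight i j"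
proof -
  have "i \<le> i * (i * 2)" by (cases i) auto
  then have "i \<le> i * (i * 2) + (i * (j * 4) + j * (j * 4))" by (rule trans_le_add1)
  then show ?thesis by (simp add: base_weight_def power2_eq_square algebra_simps)
qed

definition denom :: "nat \<Rightarrow> nat \<Rightarrow> 'a::comm_ring_1 fps" where
  "denom i j = qpochhammer (fps_X\<^sup>2) (fps_X\<^sup>2) i * qpochhammer (fps_X ^ 4) (fps_X ^ 4) j"

lemma denom_Suc1: "denom (Suc i) j = denom i j * (1 - fps_X ^ (2 * Suc i))"
  by (simp add: denom_def qpochhammer_def power_mult[symmetric] power_add[symmetric] mult_ac)

lemma denom_Suc2: "denom i (Suc j) = denom i j * (1 - fps_X ^ (4 * Suc j))"
  by (simp add: denom_def qpochhammer_def power_mult[symmetric] power_add[symmetric] mult_ac)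

text \<open>Multiplied by \<open>denom i j\<close>, the last two terms of the recurrence become
  X^base times (1 - X^(4j)) + X^(4j) (1 - X^(2i)). This telescopes to 1 - X^(2i+4j), the factor on
  the left, which cancels in a domain.\<close>

lemma weight_gf_distinct_odd_ij:
  "weight_gf sum_list (distinct_odd_partitions_ij i j) * denom i j
    = (fps_X ^ base_weight i j :: 'a::idom fps)"
proof (induction "i + j" arbitrary: i j rule: less_induct)
  case less
  let ?F = "\<lambda>i j. weight_gf sum_list (distinct_odd_partitions_ij i j) :: 'a fps"
  let ?X = "fps_X :: 'a fps"
  show ?case
  proof (cases "(i, j) = (0, 0)")
    case True
    then show ?thesis
      by (simp add: distinct_odd_partitions_ij_0_0 weight_gf_singleton denom_def qpochhammer_def)
  next
    case False
    let ?P = "case j of 0 \<Rightarrow> 0 | Suc j' \<Rightarrow> ?X ^ (4 + 4 * (i + 2 * j')) * ?F i j'"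
    let ?S = "case i of 0 \<Rightarrow> 0 | Suc i' \<Rightarrow> ?X ^ (1 + 4 * (i' + 2 * j)) * ?F i' j"
    \<comment> \<open>The weight added by a pair is exactly the increase of
      \<open>base_weight\<close>; for \<open>j = 0\<close> both sides vanish.\<close>
    have P: "?P * denom i j = ?X ^ base_weight i j * (1 - ?X ^ (4 * j))"
    proof (cases j)
      case (Suc j')
      have "?P * denom i j = ?X ^ (4 + 4 * (i + 2 * j')) * (?F i j' * denom i j') * (1 - ?X ^ (4 * j))"
        by (simp add: Suc denom_Suc2 mult_ac)
      also have "?F i j' * denom i j' = ?X ^ base_weight i j'" using less[of i j'] Suc by simp
      finally show ?thesis by (simp add: Suc base_weight_Suc2 power_add[symmetric] algebra_simps)
    qed simp
    \<comment> \<open>A single adds \<open>4 * j\<close> more than the increase of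
      \<open>base_weight\<close>, which explains the extra power.\<close>
    have S: "?S * denom i j = ?X ^ base_weight i j * ?X ^ (4 * j) * (1 - ?X ^ (2 * i))"
    proof (cases i)
      case (Suc i')
      have "?S * denom i j = ?X ^ (1 + 4 * (i' + 2 * j)) * (?F i' j * denom i' j) * (1 - ?X ^ (2 * i))"
        by (simp add: Suc denom_Suc1 mult_ac)
      also have "?F i' j * denom i' j = ?X ^ base_weight i' j" using less[of i' j] Suc by simp
      also have "?X ^ (1 + 4 * (i' + 2 * j)) * ?X ^ base_weight i' j = ?X ^ base_weight i j * ?X ^ (4 * j)"
        unfolding power_add[symmetric] Suc base_weight_Suc1 by (simp add: algebra_simps)
      finally show ?thesis .
    qed simp
    let ?u = "?X ^ (2 * (i + 2 * j))"
    have "?F i j * (1 - ?u) = ?P + ?S"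
      using weight_gf_distinct_odd_ij_rec[OF False, where 'a = 'a] by (simp add: algebra_simps)
    then have "?F i j * (1 - ?u) * denom i j = ?P * denom i j + ?S * denom i j"
      by (simp only: distrib_right)
    then have "?F i j * denom i j * (1 - ?u) = ?P * denom i j + ?S * denom i j"
      by (simp only: mult_ac)
    also have "\<dots> = ?X ^ base_weight i j * (1 - ?u)"
      unfolding P S by (simp add: algebra_simps power_add[symmetric])
    finally have "?F i j * denom i j * (1 - ?u) = ?X ^ base_weight i j * (1 - ?u)" .
    \<comment> \<open>The exponent is positive as \<open>(i, j)\<close> is not
      \<open>(0, 0)\<close>, so the constant coefficient is 1.\<close>
    moreover have "1 - ?u \<noteq> 0"
    proof
      assume "1 - ?u = 0"
      then have "fps_nth (1 - ?u) 0 = 0" by simp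
      with False show False by (auto simp: fps_X_power_nth)
    qed
    ultimately show ?thesis by simp
  qed
qed

section \<open>Base partitions\<close>

lemma base_partition_0_0: "base_partition 0 0 = []"
  by (simp add: base_partition_def)

text \<open>Base partitions arise from the empty one by inserting all singles first, hence
  \<open>j = 0\<close> here, and then the pairs.\<close>

lemma base_partition_Suc1: "base_partition (Suc i) 0 = insert_single (base_partition i 0)"
  by (simp add: base_partition_def insert_single_def upt_conv_Cons map_Suc_upt[symmetric] o_def del: upt_Suc)

lemma base_partition_Suc2: "base_partition i (Suc j) = insert_pair (base_partition i j)"
proof -
  have "[0..<2 * Suc j] = 0 # 1 # map ((+) 2) [0..<2 * j]"
    by (intro nth_equalityI) (auto simp: nth_Cons' nth_append simp del: upt_Suc)
  then show ?thesis by (simp add: base_partition_def insert_pair_def o_def)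
qed

lemma base_partition_mem: "base_partition i j \<in> distinct_odd_partitions_ij i j"
proof (induction j)
  case 0
  show ?case
    by (induction i)
       (simp_all add: base_partition_0_0 distinct_odd_partitions_ij_0_0 base_partition_Suc1 insert_single_mem)
qed (simp add: base_partition_Suc2 insert_pair_mem)

lemma sum_list_base_partition: "sum_list (base_partition i j) = base_weight i j"
proof (induction j)
  case 0
  have "length (base_partition i 0) = i" for i by (simp add: base_partition_def)
  then show ?case
    by (induction i)
       (simp_all add: base_partition_0_0 base_partition_Suc1 insert_single_def sum_list_map_add base_weight_Suc1)
next
  case (Suc j)
  have "length (base_partition i j) = i + 2 * j" by (simp add: base_partition_def)
  with Suc show ?case
    by (simp add: base_partition_Suc2 insert_pair_def sum_list_map_add base_weight_Suc2)
qed

section \<open>The bijection\<close>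

text \<open>Only the weight has to be tracked: length and \<open>sol2\<close> are fixed by
  membership in the target set.\<close>

lemma ex_bijection:
  obtains \<alpha> where
    "bij_betw \<alpha> ({base_partition i j} \<times> multiple_partitions 2 i \<times> multiple_partitions 4 j)
      (distinct_odd_partitions_ij i j)"
    "\<And>\<mu> \<eta>. \<mu> \<in> multiple_partitions 2 i \<Longrightarrow> \<eta> \<in> multiple_partitions 4 j \<Longrightarrow>
      sum_list (\<alpha> (base_partition i j, \<mu>, \<eta>)) = sum_list (base_partition i j) + sum_list \<mu> + sum_list \<eta>"
proof -
  let ?M = "multiple_partitions 2 i" and ?N = "multiple_partitions 4 j" and ?B = "{base_partition i j}"
  let ?A = "distinct_odd_partitions_ij i j"
  let ?v = "\<lambda>x. sum_list (fst x) + sum_list (snd x) :: nat"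
  \<comment> \<open>Nested like the triple product, so that \<open>weight_gf_Times\<close> applies
    twice.\<close>
  let ?w = "\<lambda>x. sum_list (fst x) + ?v (snd x) :: nat"
  have B: "finite_fibers sum_list ?B" by (simp add: finite_fibers_def)
  have MN: "finite_fibers ?v (?M \<times> ?N)"
    by (intro finite_fibers_Times finite_fibers_multiple_partitions)
  have "weight_gf ?w (?B \<times> ?M \<times> ?N) * denom i j
      = fps_X ^ base_weight i j * (weight_gf sum_list ?M * qpochhammer (fps_X\<^sup>2) (fps_X\<^sup>2) i)
        * (weight_gf sum_list ?N * qpochhammer (fps_X ^ 4) (fps_X ^ 4) j :: rat fps)"
    unfolding weight_gf_Times[OF B MN]
      weight_gf_Times[OF finite_fibers_multiple_partitions finite_fibers_multiple_partitions]
    by (simp add: weight_gf_singleton sum_list_base_partition denom_def mult_ac)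
  also have "\<dots> = fps_X ^ base_weight i j"
    by (simp add: weight_gf_multiple_partitions)
  finally have eq: "weight_gf ?w (?B \<times> ?M \<times> ?N) * denom i j = (weight_gf sum_list ?A * denom i j :: rat fps)"
    by (simp add: weight_gf_distinct_odd_ij)
  \<comment> \<open>A multiple of \<open>denom i j\<close> is a power of the indeterminate.\<close>
  have "denom i j \<noteq> (0 :: rat fps)"
  proof
    assume "denom i j = (0 :: rat fps)"
    with weight_gf_distinct_odd_ij[of i j, where 'a = rat] show False by simp
  qed
  with eq have "weight_gf ?w (?B \<times> ?M \<times> ?N) = (weight_gf sum_list ?A :: rat fps)" by simp
  from weight_preserving_bij[OF finite_fibers_Times[OF B MN] finite_fibers_distinct_odd_ij this]
  obtain \<alpha> where "bij_betw \<alpha> (?B \<times> ?M \<times> ?N) ?A"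
    "\<And>x. x \<in> ?B \<times> ?M \<times> ?N \<Longrightarrow> sum_list (\<alpha> x) = ?w x"
    by blast
  then show thesis by (intro that[of \<alpha>]) (auto simp: add_ac)
qed

section \<open>The double series\<close>

text \<open>The coefficient ring \<open>rat fps fps\<close> is not a field, so the quotient is
  genuine only because the denominator has constant coefficient 1, whose \<open>inverse\<close> is
  1.\<close>

lemma denom_quotient:
  "c * q_var ^ base_weight i j / denom i j = c * weight_gf sum_list (distinct_odd_partitions_ij i j)"
  for c :: "rat fps fps fps"
proof -
  let ?d = "denom i j :: rat fps fps fps"
  let ?F = "weight_gf sum_list (distinct_odd_partitions_ij i j) :: rat fps fps fps"
  have q: "fps_nth (qpochhammer (fps_X ^ k) (fps_X ^ k) n) 0 = (1 :: rat fps fps)" if "0 < k" for k n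
    unfolding qpochhammer_def using that by (induction n) (simp_all add: fps_mult_nth_0)
  have d0: "fps_nth ?d 0 = 1" by (simp add: denom_def q)
  have inv1: "inverse (1 :: rat fps fps) = 1" by (simp add: fps_inverse_one')
  have "?d * inverse ?d = 1"
    unfolding fps_inverse_def[of ?d] by (rule fps_right_inverse) (simp add: d0 inv1)
  moreover have "c * q_var ^ base_weight i j / ?d = c * (?F * ?d) * inverse ?d"
    using d0 by (simp add: fps_divide_unit weight_gf_distinct_odd_ij q_var_def)
  ultimately show ?thesis by (simp add: mult.assoc)
qed

lemma xy_const: "x_var ^ i * y_var ^ n = fps_const (fps_const fps_X ^ i * fps_X ^ n)"
  by (simp add: x_var_def y_var_def fps_const_power)

text \<open>The index pair of the set that contains \<open>\<pi>\<close>; the division is exact by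
  \<open>sol2_add_even_length\<close>.\<close>

definition block :: "nat list \<Rightarrow> nat \<times> nat" where
  "block \<pi> = (sol2 \<pi>, (length \<pi> - sol2 \<pi>) div 2)"

lemma block_eq_iff: "block \<pi> = (i, j) \<longleftrightarrow> length \<pi> = i + 2 * j \<and> sol2 \<pi> = i"
  using sol2_add_even_length[of \<pi>] by (auto simp: block_def)

text \<open>Both sums are evaluated coefficientwise: the n-th coefficient is a finite sum over
  partitions of weight n, grouped by \<open>block\<close> in the second case. Since \<open>c\<close>
  never vanishes, the terms contributing to the first are exactly \<open>D n\<close>.\<close>

lemma has_sum_double_series:
  fixes c :: "nat \<Rightarrow> nat \<Rightarrow> 'a::idom"
  assumes c: "\<And>i n. c i n \<noteq> 0"
  shows "\<exists>S. ((\<lambda>\<pi>. fps_const (c (sol2 \<pi>) (length \<pi>)) * fps_X ^ sum_list \<pi>) has_sum S)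
        distinct_odd_partitions
    \<and> ((\<lambda>(i, j). fps_const (c i (i + 2 * j)) * weight_gf sum_list (distinct_odd_partitions_ij i j))
        has_sum S) UNIV"
proof -
  define D where "D n = {\<pi> \<in> distinct_odd_partitions. sum_list \<pi> = n}" for n
  have fin: "finite (D n)" for n
    using finite_fibers_distinct_odd by (auto simp: finite_fibers_def D_def)
  define S where "S = Abs_fps (\<lambda>n. \<Sum>\<pi>\<in>D n. c (sol2 \<pi>) (length \<pi>))"
  let ?f = "\<lambda>\<pi>. fps_const (c (sol2 \<pi>) (length \<pi>)) * fps_X ^ sum_list \<pi>"
  let ?g = "\<lambda>(i, j). fps_const (c i (i + 2 * j)) * weight_gf sum_list (distinct_odd_partitions_ij i j)"
  have fn: "fps_nth (?f \<pi>) n = (if sum_list \<pi> = n then c (sol2 \<pi>) (length \<pi>) else 0)" for \<pi> n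
    by (simp add: fps_X_power_nth)
  have "{\<pi> \<in> distinct_odd_partitions. fps_nth (?f \<pi>) n \<noteq> 0} = D n" for n
    unfolding fn D_def using c by auto
  moreover have "fps_nth S n = (\<Sum>\<pi>\<in>D n. fps_nth (?f \<pi>) n)" for n
    unfolding fn S_def by (auto simp: D_def intro!: sum.cong)
  ultimately have 1: "(?f has_sum S) distinct_odd_partitions"
    using fin by (intro has_sum_fpsI) auto
  have fiber: "{\<pi> \<in> distinct_odd_partitions_ij i j. sum_list \<pi> = n} = {\<pi> \<in> D n. block \<pi> = (i, j)}" for i j n
    by (auto simp: block_eq_iff D_def distinct_odd_partitions_ij_def)
  have gn: "fps_nth (?g p) n = (\<Sum>\<pi> | \<pi> \<in> D n \<and> block \<pi> = p. c (sol2 \<pi>) (length \<pi>))" for p n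
  proof (cases p)
    case (Pair i j)
    have "(\<Sum>\<pi> | \<pi> \<in> D n \<and> block \<pi> = p. c (sol2 \<pi>) (length \<pi>))
        = (\<Sum>\<pi> | \<pi> \<in> D n \<and> block \<pi> = p. c i (i + 2 * j))"
      by (rule sum.cong) (auto simp: Pair block_eq_iff)
    then show ?thesis by (simp add: Pair fiber mult.commute)
  qed
  \<comment> \<open>Only blocks containing a partition of weight \<open>n\<close> contribute, which
    gives finite support.\<close>
  have sub: "{p \<in> UNIV. fps_nth (?g p) n \<noteq> 0} \<subseteq> block ` D n" for n
  proof
    fix p assume p: "p \<in> {p \<in> UNIV. fps_nth (?g p) n \<noteq> 0}"
    show "p \<in> block ` D n"
    proof (rule ccontr)
      assume "p \<notin> block ` D n"
      then have "{\<pi>. \<pi> \<in> D n \<and> block \<pi> = p} = {}" by auto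
      with p show False unfolding gn by simp
    qed
  qed
  have "(?g has_sum S) UNIV"
  proof (rule has_sum_fpsI)
    fix n
    show "finite {p \<in> UNIV. fps_nth (?g p) n \<noteq> 0}" using sub fin finite_subset by blast
    have "fps_nth S n = (\<Sum>p\<in>block ` D n. fps_nth (?g p) n)"
      unfolding gn
      using sum.group[OF fin finite_imageI[OF fin] order_refl,
          where g = block and h = "\<lambda>\<pi>. c (sol2 \<pi>) (length \<pi>)", symmetric]
      by (simp add: S_def)
    also have "\<dots> = (\<Sum>p | p \<in> UNIV \<and> fps_nth (?g p) n \<noteq> 0. fps_nth (?g p) n)"
      by (rule sum.mono_neutral_right) (use fin sub in auto)
    finally show "fps_nth S n = (\<Sum>p | p \<in> UNIV \<and> fps_nth (?g p) n \<noteq> 0. fps_nth (?g p) n)" .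
  qed
  with 1 show ?thesis by blast
qed

theorem theorem2p1:
  shows "(\<forall>i j :: nat. \<exists>\<alpha> :: nat list \<times> nat list \<times> nat list \<Rightarrow> nat list.
           bij_betw \<alpha>
             ({base_partition i j} \<times> multiple_partitions 2 i \<times> multiple_partitions 4 j)
             (distinct_odd_partitions_ij i j) \<and>
           (\<forall>\<mu> \<in> multiple_partitions 2 i. \<forall>\<eta> \<in> multiple_partitions 4 j.
              sum_list (\<alpha> (base_partition i j, \<mu>, \<eta>)) =
                sum_list (base_partition i j) + sum_list \<mu> + sum_list \<eta> \<and>
              length (\<alpha> (base_partition i j, \<mu>, \<eta>)) = length (base_partition i j) \<and>
              sol2 (\<alpha> (base_partition i j, \<mu>, \<eta>)) = sol2 (base_partition i j)))
       \<and> (\<lambda>\<pi>. x_var ^ sol2 \<pi> * y_var ^ length \<pi> * q_var ^ sum_list \<pi>)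
           summable_on distinct_odd_partitions
       \<and> (\<lambda>(i, j). x_var ^ i * y_var ^ (i + 2 * j) * q_var ^ (2 * i\<^sup>2 + 4 * j\<^sup>2 + 4 * i * j - i)
             / (qpochhammer (q_var\<^sup>2) (q_var\<^sup>2) i * qpochhammer (q_var ^ 4) (q_var ^ 4) j))
           summable_on (UNIV :: (nat \<times> nat) set)
       \<and> (\<Sum>\<^sub>\<infinity>\<pi>\<in>distinct_odd_partitions.
             x_var ^ sol2 \<pi> * y_var ^ length \<pi> * q_var ^ sum_list \<pi>) =
         (\<Sum>\<^sub>\<infinity>(i, j)\<in>(UNIV :: (nat \<times> nat) set).
             x_var ^ i * y_var ^ (i + 2 * j) * q_var ^ (2 * i\<^sup>2 + 4 * j\<^sup>2 + 4 * i * j - i)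
             / (qpochhammer (q_var\<^sup>2) (q_var\<^sup>2) i * qpochhammer (q_var ^ 4) (q_var ^ 4) j))"
proof -
  let ?DO = distinct_odd_partitions
  let ?f = "\<lambda>\<pi>. x_var ^ sol2 \<pi> * y_var ^ length \<pi> * q_var ^ sum_list \<pi>"
  let ?g = "\<lambda>(i, j). x_var ^ i * y_var ^ (i + 2 * j) * q_var ^ (2 * i\<^sup>2 + 4 * j\<^sup>2 + 4 * i * j - i)
     / (qpochhammer (q_var\<^sup>2) (q_var\<^sup>2) i * qpochhammer (q_var ^ 4) (q_var ^ 4) j)"
  have bij: "\<exists>\<alpha> :: nat list \<times> nat list \<times> nat list \<Rightarrow> nat list.
           bij_betw \<alpha>
             ({base_partition i j} \<times> multiple_partitions 2 i \<times> multiple_partitions 4 j)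
             (distinct_odd_partitions_ij i j) \<and>
           (\<forall>\<mu> \<in> multiple_partitions 2 i. \<forall>\<eta> \<in> multiple_partitions 4 j.
              sum_list (\<alpha> (base_partition i j, \<mu>, \<eta>)) =
                sum_list (base_partition i j) + sum_list \<mu> + sum_list \<eta> \<and>
              length (\<alpha> (base_partition i j, \<mu>, \<eta>)) = length (base_partition i j) \<and>
              sol2 (\<alpha> (base_partition i j, \<mu>, \<eta>)) = sol2 (base_partition i j))" for i j
  proof -
    obtain \<alpha> where \<alpha>: "bij_betw \<alpha> ({base_partition i j} \<times> multiple_partitions 2 i \<times> multiple_partitions 4 j)
        (distinct_odd_partitions_ij i j)"
      "\<And>\<mu> \<eta>. \<mu> \<in> multiple_partitions 2 i \<Longrightarrow> \<eta> \<in> multiple_partitions 4 j \<Longrightarrow>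
        sum_list (\<alpha> (base_partition i j, \<mu>, \<eta>)) = sum_list (base_partition i j) + sum_list \<mu> + sum_list \<eta>"
      using ex_bijection by blast
    \<comment> \<open>The image and the base partition lie in the same set, so length and
      \<open>sol2\<close> agree.\<close>
    have "\<alpha> (base_partition i j, \<mu>, \<eta>) \<in> distinct_odd_partitions_ij i j"
      if "\<mu> \<in> multiple_partitions 2 i" "\<eta> \<in> multiple_partitions 4 j" for \<mu> \<eta>
      using bij_betwE[OF \<alpha>(1)] that by blast
    with \<alpha> base_partition_mem[of i j] show ?thesis
      by (intro exI[of _ \<alpha>]) (simp add: distinct_odd_partitions_ij_iff)
  qed
  \<comment> \<open>The monomial in x and y is constant in q and plays the part of the coefficient
    \<open>c\<close>.\<close>
  have f: "?f = (\<lambda>\<pi>. fps_const (fps_const fps_X ^ sol2 \<pi> * fps_X ^ length \<pi>) * fps_X ^ sum_list \<pi>)"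
    by (simp add: xy_const q_var_def)
  have g: "?g = (\<lambda>(i, j). fps_const (fps_const fps_X ^ i * fps_X ^ (i + 2 * j)) *
      weight_gf sum_list (distinct_odd_partitions_ij i j))"
    using denom_quotient unfolding denom_def base_weight_def q_var_def xy_const
    by (intro ext) auto
  have "fps_const fps_X ^ i * fps_X ^ n \<noteq> (0 :: rat fps fps)" for i n :: nat
    by simp
  from has_sum_double_series[of "\<lambda>i n. fps_const fps_X ^ i * fps_X ^ n :: rat fps fps", OF this]
  obtain S where "(?f has_sum S) ?DO" "(?g has_sum S) UNIV"
    unfolding f g by blast
  \<comment> \<open>The common value \<open>S\<close> yields both summability claims and the
    equality of the sums.\<close>
  then show ?thesis
    using bij infsumI has_sum_imp_summable by (metis (no_types, lifting))
qed

end
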